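(* Let $\mathfrak{A}=(A;\vee,\wedge,\odot,\rightarrow,0,1)$ be a residuated lattice. The following assertions are equivalent: (1) any two distinct minimal prime filters of $\mathfrak{A}$ are comaximal, i.e. $\mathfrak{m}\veebar\mathfrak{n}=A$ for all distinct minimal prime filters $\mathfrak{m},\mathfrak{n}$; (2) $\mathfrak{A}$ is mp; (3) for any prime filter $\mathfrak{p}$ of $\mathfrak{A}$, $D(\mathfrak{p})$ is a prime filter of $\mathfrak{A}$; (4) for any maximal filter $\mathfrak{m}$ of $\mathfrak{A}$, $D(\mathfrak{m})$ is a prime filter of $\mathfrak{A}$; (5) for all $x,y\in A$ with $x\vee y=1$, $x^{\perp}\veebar y^{\perp}=A$; (6) for all $x,y\in A$ with $x\vee y=1$, there exists $a\in A$ such that $a\in x^{\perp}$ and $\neg a\in y^{\perp}$; (7) for all $x,y\in A$, $(x\vee y)^{\perp}=x^{\perp}\veebar y^{\perp}$; (8) for all $x,y\in A$, $(x\vee y)^{\perp}=A$ implies $x^{\perp}\veebar y^{\perp}=A$.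
   Context: A residuated lattice is an algebra $\mathfrak{A}=(A;\vee,\wedge,\odot,\rightarrow,0,1)$ such that $(A;\vee,\wedge,0,1)$ is a bounded lattice, $(A;\odot,1)$ is a commutative monoid, and $x\odot y\leq z$ iff $x\leq y\rightarrow z$ for all $x,y,z\in A$. Put $\neg a:=a\rightarrow 0$. A filter of $\mathfrak{A}$ is a non-empty subset $F\subseteq A$ with $x\odot y\in F$ for all $x,y\in F$, and $x\vee y\in F$ for all $x\in F$, $y\in A$ (so $F$ is upward closed). $F$ is proper if $F\neq A$. For filters $F,G$, $F\veebar G$ denotes the filter generated by $F\cup G$. A maximal filter is a maximal element of the set of proper filters. A prime filter is a proper filter $\mathfrak{p}$ that is meet-irreducible among filters (equivalently, $x\vee y\in\mathfrak{p}$ implies $x\in\mathfrak{p}$ or $y\in\mathfrak{p}$). A minimal prime filter is a minimal element (under inclusion) of the set of prime filters. $\mathfrak{A}$ is called mp if every prime filter of $\mathfrak{A}$ contains a unique minimal prime filter. For $x\in A$, $x^{\perp}=\{a\in A\mid a\vee x=1\}$ (equivalently, the intersection of all prime filters not containing $x$). For a proper filter $H$, $D(H)=\{a\in A\mid a\vee x=1\text{ for some }x\in A\setminus H\}$. *)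

theory Defs
  imports Main
begin

text \<open>
  The universe of the algebra is the whole type, the bounds 0 and 1 of the underlying lattice are
  \<open>bot\<close> and \<open>top\<close>, and the monoid unit \<open>1\<close> is identified with \<open>top\<close>.
  The degenerate algebra with \<open>bot = top\<close> is allowed.
\<close>

class residuated_lattice = bounded_lattice + comm_monoid_mult +
  fixes residuum :: "'a \<Rightarrow> 'a \<Rightarrow> 'a"  (infixr "\<leadsto>" 60)
  assumes one_eq_top: "1 = top"
    and residuation: "x * y \<le> z \<longleftrightarrow> x \<le> y \<leadsto> z"

definition rneg :: "'a::residuated_lattice \<Rightarrow> 'a"
  where "rneg a = a \<leadsto> bot"

definition rl_filter :: "'a::residuated_lattice set \<Rightarrow> bool"
  where "rl_filter F \<longleftrightarrow>
    F \<noteq> {} \<and> (\<forall>x\<in>F. \<forall>y\<in>F. x * y \<in> F) \<and> (\<forall>x\<in>F. \<forall>y. sup x y \<in> F)"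

definition proper_filter :: "'a::residuated_lattice set \<Rightarrow> bool"
  where "proper_filter F \<longleftrightarrow> rl_filter F \<and> F \<noteq> UNIV"

definition filter_gen :: "'a::residuated_lattice set \<Rightarrow> 'a set"
  where "filter_gen X = \<Inter> {F. rl_filter F \<and> X \<subseteq> F}"

definition filter_join :: "'a::residuated_lattice set \<Rightarrow> 'a set \<Rightarrow> 'a set"
    (infixl "\<squnion>\<^sub>F" 65)
  where "F \<squnion>\<^sub>F G = filter_gen (F \<union> G)"

definition maximal_filter :: "'a::residuated_lattice set \<Rightarrow> bool"
  where "maximal_filter M \<longleftrightarrow>
    proper_filter M \<and> (\<forall>F. proper_filter F \<and> M \<subseteq> F \<longrightarrow> F = M)"

text \<open>Primeness is meet-irreducibility in the lattice of filters, whose meet is intersection.\<close>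

definition prime_filter :: "'a::residuated_lattice set \<Rightarrow> bool"
  where "prime_filter P \<longleftrightarrow>
    proper_filter P \<and>
    (\<forall>F G. rl_filter F \<and> rl_filter G \<and> F \<inter> G = P \<longrightarrow> F = P \<or> G = P)"

definition minimal_prime_filter :: "'a::residuated_lattice set \<Rightarrow> bool"
  where "minimal_prime_filter M \<longleftrightarrow>
    prime_filter M \<and> (\<forall>P. prime_filter P \<and> P \<subseteq> M \<longrightarrow> P = M)"

definition mp_residuated_lattice :: "'a::residuated_lattice itself \<Rightarrow> bool"
  where "mp_residuated_lattice _ \<longleftrightarrow>
    (\<forall>P :: 'a set. prime_filter P \<longrightarrow> (\<exists>!M. minimal_prime_filter M \<and> M \<subseteq> P))"

definition perp :: "'a::residuated_lattice \<Rightarrow> 'a set"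
  where "perp x = {a. sup a x = 1}"

definition D_filter :: "'a::residuated_lattice set \<Rightarrow> 'a set"
  where "D_filter H = {a. \<exists>x. x \<notin> H \<and> sup a x = 1}"

end

theory Submission
  imports Defs
begin

text \<open>
  The proof rests on the description of \<open>D(P)\<close>, for a prime filter \<open>P\<close>, as the intersection of the
  prime filters contained in \<open>P\<close>. For \<open>a \<notin> D(P)\<close>, a prime filter
  inside \<open>P\<close> that avoids \<open>a\<close> comes from a separation theorem: a filter disjoint from a nonempty
  join-closed set \<open>S\<close> extends to a prime filter disjoint from \<open>S\<close>. It is applied to the filter
  \<open>{1}\<close> and the join-closed set generated by \<open>a\<close> and the complement of \<open>P\<close>
  (\<open>prime_below_avoiding\<close>). Consequently a minimal prime \<open>M\<close> satisfies \<open>D(M) = M\<close>, and if \<open>P\<close>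
  contains a unique minimal prime, that minimal prime is \<open>D(P)\<close>. Since \<open>D\<close> reverses inclusions,
  primeness of \<open>D(H)\<close> for a maximal \<open>H\<close> already determines the minimal prime below every prime
  contained in \<open>H\<close>: it can only be \<open>D(H)\<close>. This connects the mp property with the two conditions
  on \<open>D\<close>.

  The conditions on the filters \<open>perp x\<close> come in as follows. If \<open>sup x y = 1\<close> and some prime \<open>P\<close>
  contained both \<open>perp x\<close> and \<open>perp y\<close>, then neither \<open>x\<close> nor \<open>y\<close> would lie in \<open>D(P)\<close>; hence \<open>P\<close>
  would contain a minimal prime avoiding \<open>x\<close> and one avoiding \<open>y\<close>. These cannot be equal, because a
  prime filter contains one of \<open>x\<close> and \<open>y\<close>. Conversely, two distinct minimal primes \<open>M\<close> and \<open>N\<close> are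
  separated by a pair \<open>x \<in> M - N\<close>, \<open>y \<notin> M\<close> with \<open>sup x y = 1\<close>, and then \<open>perp x \<subseteq> N\<close>,
  \<open>perp y \<subseteq> M\<close>, so that comaximality passes from the \<open>perp\<close>s to \<open>M\<close> and \<open>N\<close>.
  The remaining conditions are elementary reformulations, using that the join of two filters
  consists of the elements above a product, and that \<open>sup z a * sup z b \<le> sup z (a * b)\<close>.
\<close>

section \<open>Arithmetic and filters\<close>

lemma mult_mono_rl:
  fixes x y u v :: "'a::residuated_lattice"
  assumes "x \<le> u" "y \<le> v"
  shows "x * y \<le> u * v"
proof -
  have right: "a * c \<le> b * c" if "a \<le> b" for a b c :: 'a
    using that order_trans residuation by blast
  have "x * y \<le> u * y" by (rule right[OF assms(1)])
  also have "u * y \<le> u * v"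
    using right[OF assms(2), of u] by (simp add: mult.commute)
  finally show ?thesis .
qed

lemma le_one_rl: "(x::'a::residuated_lattice) \<le> 1"
  by (simp add: one_eq_top)

lemma mult_le_left_rl: "(x::'a::residuated_lattice) * y \<le> x"
  using mult_mono_rl[OF order_refl le_one_rl, of x y] by simp

lemma mult_le_right_rl: "(x::'a::residuated_lattice) * y \<le> y"
  using mult_le_left_rl[of y x] by (simp add: mult.commute)

lemma sup_one_rl [simp]: "sup x (1::'a::residuated_lattice) = 1" "sup (1::'a) x = 1"
  by (simp_all add: one_eq_top)

text \<open>
  Multiplication has a right adjoint, so it distributes over joins; of the four terms in the
  expanded product, three lie below \<open>z\<close>. This inequality makes every set \<open>{u. sup u z \<in> F}\<close> with
  \<open>F\<close> a filter closed under products.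
\<close>

lemma sup_mult_sup_le:
  fixes z a b :: "'a::residuated_lattice"
  shows "sup z a * sup z b \<le> sup z (a * b)"
proof -
  have "a * z \<le> sup z (a * b)"
    by (rule le_supI1[OF mult_le_right_rl])
  then have "z * a \<le> sup z (a * b)"
    by (simp add: mult.commute)
  then have "z \<le> a \<leadsto> sup z (a * b)" by (simp add: residuation)
  moreover have "b \<le> a \<leadsto> sup z (a * b)"
    by (simp add: residuation[symmetric] mult.commute)
  ultimately have "sup z b * a \<le> sup z (a * b)"
    by (simp add: residuation)
  then have "a \<le> sup z b \<leadsto> sup z (a * b)"
    by (simp add: residuation[symmetric] mult.commute)
  moreover have "z \<le> sup z b \<leadsto> sup z (a * b)"
    using le_supI1[OF mult_le_left_rl] by (simp add: residuation[symmetric])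
  ultimately show ?thesis
    by (simp add: residuation)
qed

lemma rl_filter_mult: "rl_filter F \<Longrightarrow> x \<in> F \<Longrightarrow> y \<in> F \<Longrightarrow> x * y \<in> F"
  by (simp add: rl_filter_def)

lemma rl_filter_up:
  assumes "rl_filter F" "x \<in> F" "x \<le> y"
  shows "y \<in> F"
  using assms by (metis rl_filter_def sup.absorb2)

lemma rl_filter_one: "rl_filter F \<Longrightarrow> 1 \<in> F"
  using rl_filter_up le_one_rl unfolding rl_filter_def by blast

lemma rl_filterI:
  assumes "1 \<in> F"
    and "\<And>x y. x \<in> F \<Longrightarrow> y \<in> F \<Longrightarrow> x * y \<in> F"
    and "\<And>x y. x \<in> F \<Longrightarrow> x \<le> y \<Longrightarrow> y \<in> F"
  shows "rl_filter F"
  unfolding rl_filter_def using assms by (metis empty_iff sup.cobounded1)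

lemma rl_filter_eq_UNIV_iff:
  assumes "rl_filter F"
  shows "F = UNIV \<longleftrightarrow> bot \<in> F"
  using rl_filter_up[OF assms(1) _ bot_least] by auto

text \<open>
  For a filter \<open>F\<close> this is the analogue of the ideal quotient \<open>I : X\<close> in a ring. If
  \<open>sup x y \<in> F\<close>, the residual by \<open>{y}\<close> is a filter containing \<open>F\<close> and \<open>x\<close>; in the proofs about
  prime filters it replaces the filter generated by \<open>F\<close> and \<open>x\<close>, and with it the computations
  with powers of \<open>x\<close>. Comments below write \<open>F : X\<close> for it.
\<close>

definition filter_residual :: "'a::residuated_lattice set \<Rightarrow> 'a set \<Rightarrow> 'a set"
  where "filter_residual F X = {u. \<forall>x\<in>X. sup u x \<in> F}"

lemma rl_filter_residual:
  assumes F: "rl_filter F"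
  shows "rl_filter (filter_residual F X)"
proof (rule rl_filterI)
  show "1 \<in> filter_residual F X"
    by (simp add: filter_residual_def rl_filter_one[OF F])
next
  fix u v assume "u \<in> filter_residual F X" "v \<in> filter_residual F X"
  then show "u * v \<in> filter_residual F X"
    unfolding filter_residual_def
    using rl_filter_up[OF F rl_filter_mult[OF F] sup_mult_sup_le] by (simp add: sup.commute)
next
  fix u v assume u: "u \<in> filter_residual F X" "u \<le> v"
  have "sup v x \<in> F" if "x \<in> X" for x
    using rl_filter_up[OF F _ sup_mono[OF u(2) order_refl]] u(1) that
    by (simp add: filter_residual_def)
  then show "v \<in> filter_residual F X" by (simp add: filter_residual_def)
qed

lemma subset_filter_residual: "rl_filter F \<Longrightarrow> F \<subseteq> filter_residual F X"
  unfolding filter_residual_def rl_filter_def by blast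

lemma rl_filter_singleton_one: "rl_filter {1::'a::residuated_lattice}"
  by (simp add: rl_filter_def)

lemma perp_eq_residual: "perp x = filter_residual {1} {x}"
  by (simp add: perp_def filter_residual_def)

lemma rl_filter_perp: "rl_filter (perp x)"
  by (simp add: perp_eq_residual rl_filter_residual rl_filter_singleton_one)

lemma mem_perp_iff: "a \<in> perp x \<longleftrightarrow> sup a x = 1"
  by (simp add: perp_def)

lemma filter_join_least:
  assumes "rl_filter H" "F \<subseteq> H" "G \<subseteq> H"
  shows "F \<squnion>\<^sub>F G \<subseteq> H"
  using assms unfolding filter_join_def filter_gen_def by blast

lemma filter_join_upper: "F \<subseteq> F \<squnion>\<^sub>F G" "G \<subseteq> F \<squnion>\<^sub>F G"
  unfolding filter_join_def filter_gen_def by blast+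

lemma filter_join_mono: "F \<subseteq> F' \<Longrightarrow> G \<subseteq> G' \<Longrightarrow> F \<squnion>\<^sub>F G \<subseteq> F' \<squnion>\<^sub>F G'"
  unfolding filter_join_def filter_gen_def by blast

lemma rl_filter_join: "rl_filter (F \<squnion>\<^sub>F G)"
proof (rule rl_filterI)
  show "1 \<in> F \<squnion>\<^sub>F G"
    using rl_filter_one by (auto simp: filter_join_def filter_gen_def)
  show "x * y \<in> F \<squnion>\<^sub>F G" if "x \<in> F \<squnion>\<^sub>F G" "y \<in> F \<squnion>\<^sub>F G" for x y
    using that by (auto simp: filter_join_def filter_gen_def rl_filter_mult)
  show "y \<in> F \<squnion>\<^sub>F G" if "x \<in> F \<squnion>\<^sub>F G" "x \<le> y" for x y
    using that rl_filter_up[OF _ _ that(2)] by (auto simp: filter_join_def filter_gen_def)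
qed

lemma mem_filter_join_iff:
  assumes F: "rl_filter F" and G: "rl_filter G"
  shows "z \<in> F \<squnion>\<^sub>F G \<longleftrightarrow> (\<exists>f\<in>F. \<exists>g\<in>G. f * g \<le> z)"
proof
  let ?H = "{z. \<exists>f\<in>F. \<exists>g\<in>G. f * g \<le> z}"
  have "rl_filter ?H"
  proof (rule rl_filterI)
    show "1 \<in> ?H"
      using rl_filter_one[OF F] rl_filter_one[OF G] le_one_rl by blast
  next
    fix x y assume "x \<in> ?H" "y \<in> ?H"
    then obtain f g f' g' where mem: "f \<in> F" "g \<in> G" "f' \<in> F" "g' \<in> G"
      and le: "f * g \<le> x" "f' * g' \<le> y" by blast
    have "(f * f') * (g * g') = (f * g) * (f' * g')"
      by (simp add: ac_simps)
    then have "(f * f') * (g * g') \<le> x * y"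
      using mult_mono_rl[OF le] by simp
    then show "x * y \<in> ?H"
      using rl_filter_mult[OF F] rl_filter_mult[OF G] mem by blast
  next
    fix x y assume "x \<in> ?H" "x \<le> y"
    then show "y \<in> ?H" using order_trans by blast
  qed
  moreover have "F \<subseteq> ?H"
    using rl_filter_one[OF G] mult_le_left_rl by blast
  moreover have "G \<subseteq> ?H"
    using rl_filter_one[OF F] mult_le_right_rl by blast
  ultimately show "\<exists>f\<in>F. \<exists>g\<in>G. f * g \<le> z" if "z \<in> F \<squnion>\<^sub>F G"
    using filter_join_least that by blast
next
  assume "\<exists>f\<in>F. \<exists>g\<in>G. f * g \<le> z"
  then obtain f g where fg: "f \<in> F \<squnion>\<^sub>F G" "g \<in> F \<squnion>\<^sub>F G" "f * g \<le> z"
    using filter_join_upper by blast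
  show "z \<in> F \<squnion>\<^sub>F G"
    using rl_filter_up[OF rl_filter_join rl_filter_mult[OF rl_filter_join fg(1,2)] fg(3)] .
qed

section \<open>Prime filters and separation\<close>

lemma prime_filter_is_filter: "prime_filter P \<Longrightarrow> rl_filter P"
  by (simp add: prime_filter_def proper_filter_def)

lemma prime_filter_bot: "prime_filter P \<Longrightarrow> bot \<notin> P"
  using rl_filter_eq_UNIV_iff by (auto simp: prime_filter_def proper_filter_def)

text \<open>
  If \<open>sup x y \<in> P\<close>, then \<open>F = P : {y}\<close> contains \<open>x\<close> and \<open>G = P : F\<close> contains \<open>y\<close>. An element \<open>u\<close> of
  both satisfies \<open>u = sup u u \<in> P\<close>, so \<open>F \<inter> G = P\<close> and meet-irreducibility applies.
\<close>

lemma prime_filter_sup: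
  assumes P: "prime_filter P" and xy: "sup x y \<in> P"
  shows "x \<in> P \<or> y \<in> P"
proof -
  note flt = prime_filter_is_filter[OF P]
  define F where "F = filter_residual P {y}"
  define G where "G = filter_residual P F"
  have "F \<inter> G \<subseteq> P"
    unfolding G_def filter_residual_def[of P F] by fastforce
  moreover have "P \<subseteq> F" "P \<subseteq> G"
    unfolding F_def G_def using subset_filter_residual[OF flt] by blast+
  ultimately have "F \<inter> G = P" by blast
  moreover have "rl_filter F" "rl_filter G"
    unfolding F_def G_def by (rule rl_filter_residual[OF flt])+
  ultimately have "F = P \<or> G = P"
    using P unfolding prime_filter_def by blast
  moreover have "x \<in> F" using xy by (simp add: F_def filter_residual_def)
  moreover have "y \<in> G" by (simp add: G_def F_def filter_residual_def sup.commute)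
  ultimately show ?thesis by blast
qed

lemma prime_filterI:
  assumes "rl_filter P" "bot \<notin> P"
    and "\<And>x y. sup x y \<in> P \<Longrightarrow> x \<in> P \<or> y \<in> P"
  shows "prime_filter P"
proof -
  have "F = P \<or> G = P" if FG: "rl_filter F" "rl_filter G" "F \<inter> G = P" for F G
  proof (rule ccontr)
    assume "\<not> (F = P \<or> G = P)"
    then obtain f g where fg: "f \<in> F" "f \<notin> P" "g \<in> G" "g \<notin> P" using FG(3) by blast
    then have "sup f g \<in> F \<inter> G"
      using FG(1,2) rl_filter_up[OF _ _ sup.cobounded1] rl_filter_up[OF _ _ sup.cobounded2] by blast
    then show False using FG(3) assms(3) fg by blast
  qed
  then show ?thesis
    using assms(1,2) by (auto simp: prime_filter_def proper_filter_def)
qed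

lemma exists_maximal_disjoint_filter:
  assumes F: "rl_filter F" and disj: "F \<inter> S = {}"
  obtains P where "rl_filter P" "F \<subseteq> P" "P \<inter> S = {}"
    and "\<forall>Q. rl_filter Q \<and> P \<subseteq> Q \<and> Q \<inter> S = {} \<longrightarrow> Q = P"
proof -
  let ?A = "{P. rl_filter P \<and> F \<subseteq> P \<and> P \<inter> S = {}}"
  have "\<exists>P\<in>?A. \<forall>Q\<in>?A. P \<subseteq> Q \<longrightarrow> Q = P"
  proof (rule subset_Zorn_nonempty)
    show "?A \<noteq> {}" using F disj by blast
  next
    fix C assume ne: "C \<noteq> {}" and chain: "subset.chain ?A C"
    then have flt: "\<And>Q. Q \<in> C \<Longrightarrow> rl_filter Q"
      and total: "\<And>Q R. Q \<in> C \<Longrightarrow> R \<in> C \<Longrightarrow> Q \<subseteq> R \<or> R \<subseteq> Q"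
      unfolding subset.chain_def by blast+
    have "rl_filter (\<Union>C)"
    proof (rule rl_filterI)
      show "1 \<in> \<Union>C" using ne flt rl_filter_one by blast
    next
      fix x y assume "x \<in> \<Union>C" "y \<in> \<Union>C"
      then obtain Q where "Q \<in> C" "x \<in> Q" "y \<in> Q" using total by blast
      then show "x * y \<in> \<Union>C" using flt rl_filter_mult by blast
    next
      fix x y assume "x \<in> \<Union>C" "x \<le> y"
      then show "y \<in> \<Union>C" using flt rl_filter_up by blast
    qed
    moreover have "F \<subseteq> \<Union>C" "\<Union>C \<inter> S = {}"
      using ne chain unfolding subset.chain_def by blast+
    ultimately show "\<Union>C \<in> ?A" by blast
  qed
  then obtain P where P: "P \<in> ?A" and max: "\<forall>Q\<in>?A. P \<subseteq> Q \<longrightarrow> Q = P" ..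
  show ?thesis
  proof (rule that[of P])
    show "rl_filter P" "F \<subseteq> P" "P \<inter> S = {}" using P by simp_all
    show "\<forall>Q. rl_filter Q \<and> P \<subseteq> Q \<and> Q \<inter> S = {} \<longrightarrow> Q = P"
      using max P by auto
  qed
qed

text \<open>
  Suppose \<open>sup x y \<in> P\<close> with \<open>x, y \<notin> P\<close>. Maximality is used twice: \<open>P : {y}\<close> contains \<open>x\<close>, hence
  meets \<open>S\<close>, say in \<open>s\<close>; then \<open>P : {s}\<close> contains \<open>y\<close>, hence meets \<open>S\<close>, say in \<open>t\<close>. So \<open>sup t s \<in> P\<close>,
  although \<open>S\<close> is closed under joins.
\<close>

lemma maximal_disjoint_filter_prime:
  assumes P: "rl_filter P" and disj: "P \<inter> S = {}" and S: "S \<noteq> {}"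
    and sup_closed: "\<And>s t. s \<in> S \<Longrightarrow> t \<in> S \<Longrightarrow> sup s t \<in> S"
    and max: "\<And>Q. rl_filter Q \<Longrightarrow> P \<subseteq> Q \<Longrightarrow> Q \<inter> S = {} \<Longrightarrow> Q = P"
  shows "prime_filter P"
proof (rule prime_filterI[OF P])
  show "bot \<notin> P"
    using rl_filter_eq_UNIV_iff[OF P] disj S by blast
next
  have meets: "\<exists>s\<in>S. sup s u \<in> P" if "sup v u \<in> P" "v \<notin> P" for u v
  proof -
    have "v \<in> filter_residual P {u}" using that(1) by (simp add: filter_residual_def)
    then have "filter_residual P {u} \<inter> S \<noteq> {}"
      using max[OF rl_filter_residual[OF P] subset_filter_residual[OF P], of "{u}"] that(2) by blast
    then show ?thesis by (auto simp: filter_residual_def)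
  qed
  fix x y assume xy: "sup x y \<in> P"
  show "x \<in> P \<or> y \<in> P"
  proof (rule ccontr)
    assume "\<not> (x \<in> P \<or> y \<in> P)"
    then have x: "x \<notin> P" and y: "y \<notin> P" by auto
    obtain s where s: "s \<in> S" "sup s y \<in> P" using meets[OF xy x] by blast
    then have "sup y s \<in> P" by (simp add: sup.commute)
    from meets[OF this y] obtain t where "t \<in> S" "sup t s \<in> P" by blast
    then show False using sup_closed s(1) disj by blast
  qed
qed

lemma prime_filter_separation:
  assumes "rl_filter F" "F \<inter> S = {}" "S \<noteq> {}"
    and "\<And>s t. s \<in> S \<Longrightarrow> t \<in> S \<Longrightarrow> sup s t \<in> S"
  shows "\<exists>P. prime_filter P \<and> F \<subseteq> P \<and> P \<inter> S = {}"
proof -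
  obtain P where P: "rl_filter P" "F \<subseteq> P" "P \<inter> S = {}"
    and max: "\<forall>Q. rl_filter Q \<and> P \<subseteq> Q \<and> Q \<inter> S = {} \<longrightarrow> Q = P"
    by (rule exists_maximal_disjoint_filter[OF assms(1,2)])
  have "prime_filter P"
    by (rule maximal_disjoint_filter_prime[OF P(1,3) assms(3,4)]) (simp_all add: max)
  then show ?thesis using P by blast
qed

text \<open>For \<open>S = {bot}\<close>, being maximal among the filters disjoint from \<open>S\<close> is being a maximal filter.\<close>

lemma maximal_filter_prime:
  assumes "maximal_filter H"
  shows "prime_filter H"
proof (rule maximal_disjoint_filter_prime[where S = "{bot}"])
  show flt: "rl_filter H"
    using assms by (simp add: maximal_filter_def proper_filter_def)
  show "H \<inter> {bot} = {}"
    using assms rl_filter_eq_UNIV_iff[OF flt] by (auto simp: maximal_filter_def proper_filter_def)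
  show "Q = H" if "rl_filter Q" "H \<subseteq> Q" "Q \<inter> {bot} = {}" for Q
    using assms that by (auto simp: maximal_filter_def proper_filter_def)
qed simp_all

lemma exists_maximal_filter_above:
  assumes "proper_filter F"
  shows "\<exists>H. maximal_filter H \<and> F \<subseteq> H"
proof -
  have F: "rl_filter F" "F \<inter> {bot} = {}"
    using assms rl_filter_eq_UNIV_iff by (auto simp: proper_filter_def)
  obtain H where H: "rl_filter H" "F \<subseteq> H" "H \<inter> {bot} = {}"
    and max: "\<forall>Q. rl_filter Q \<and> H \<subseteq> Q \<and> Q \<inter> {bot} = {} \<longrightarrow> Q = H"
    by (rule exists_maximal_disjoint_filter[OF F])
  have "maximal_filter H"
    unfolding maximal_filter_def proper_filter_def
    using H(1,3) max rl_filter_eq_UNIV_iff by auto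
  then show ?thesis using H(2) by blast
qed

section \<open>Minimal primes and the sets D(P)\<close>

text \<open>
  Zorn's lemma applied to complements: the intersection of a chain of prime filters is prime, since
  if it misses both \<open>x\<close> and \<open>y\<close>, then so does a single member of the chain.
\<close>

lemma exists_minimal_prime_below:
  assumes P: "prime_filter P"
  shows "\<exists>M. minimal_prime_filter M \<and> M \<subseteq> P"
proof -
  let ?A = "{U. prime_filter (- U) \<and> - U \<subseteq> P}"
  have "\<exists>U\<in>?A. \<forall>V\<in>?A. U \<subseteq> V \<longrightarrow> V = U"
  proof (rule subset_Zorn_nonempty)
    show "?A \<noteq> {}" using P by (auto intro!: exI[of _ "- P"])
  next
    fix C assume ne: "C \<noteq> {}" and chain: "subset.chain ?A C"
    then have pr: "\<And>U. U \<in> C \<Longrightarrow> prime_filter (- U)"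
      and sub: "\<And>U. U \<in> C \<Longrightarrow> - U \<subseteq> P"
      and total: "\<And>U V. U \<in> C \<Longrightarrow> V \<in> C \<Longrightarrow> U \<subseteq> V \<or> V \<subseteq> U"
      unfolding subset.chain_def by blast+
    note flt = prime_filter_is_filter[OF pr]
    have "prime_filter (- \<Union>C)"
    proof (rule prime_filterI)
      show "rl_filter (- \<Union>C)"
      proof (rule rl_filterI)
        show "1 \<in> - \<Union>C" using rl_filter_one[OF flt] by blast
        show "x * y \<in> - \<Union>C" if "x \<in> - \<Union>C" "y \<in> - \<Union>C" for x y
          using that rl_filter_mult[OF flt] by blast
        show "y \<in> - \<Union>C" if "x \<in> - \<Union>C" "x \<le> y" for x y
          using that rl_filter_up[OF flt] by blast
      qed
      show "bot \<notin> - \<Union>C" using ne prime_filter_bot[OF pr] by blast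
      fix x y assume xy: "sup x y \<in> - \<Union>C"
      show "x \<in> - \<Union>C \<or> y \<in> - \<Union>C"
      proof (rule ccontr)
        assume "\<not> (x \<in> - \<Union>C \<or> y \<in> - \<Union>C)"
        then obtain U where "U \<in> C" "x \<in> U" "y \<in> U" using total by blast
        then show False using prime_filter_sup[OF pr] xy by blast
      qed
    qed
    moreover have "- \<Union>C \<subseteq> P" using ne sub by blast
    ultimately show "\<Union>C \<in> ?A" by blast
  qed
  then obtain U where "U \<in> ?A" and max: "\<forall>V\<in>?A. U \<subseteq> V \<longrightarrow> V = U" ..
  then have U: "prime_filter (- U)" "- U \<subseteq> P" by simp_all
  have "Q = - U" if "prime_filter Q" "Q \<subseteq> - U" for Q
    using max[rule_format, of "- Q"] that U(2) by auto
  then show ?thesis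
    using U unfolding minimal_prime_filter_def by blast
qed

lemma perp_subset_prime:
  assumes "prime_filter P" "x \<notin> P"
  shows "perp x \<subseteq> P"
  using assms prime_filter_sup[OF assms(1)] rl_filter_one[OF prime_filter_is_filter]
  by (metis mem_perp_iff subsetI)

lemma D_filter_eq_Union_perp: "D_filter H = (\<Union>x\<in>- H. perp x)"
  by (auto simp: D_filter_def perp_def)

lemma D_filter_antimono: "H \<subseteq> K \<Longrightarrow> D_filter K \<subseteq> D_filter H"
  unfolding D_filter_def by blast

lemma D_filter_subset_prime: "prime_filter P \<Longrightarrow> D_filter P \<subseteq> P"
  using perp_subset_prime by (auto simp: D_filter_eq_Union_perp)

text \<open>
  The complement of a prime filter \<open>P\<close> is closed under joins, and so is the set of all \<open>x\<close> and
  \<open>sup a x\<close> with \<open>x \<notin> P\<close>. The assumption \<open>a \<notin> D(P)\<close> says that this set does not contain \<open>1\<close>, so a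
  prime filter can be separated from it; the set contains \<open>a = sup a bot\<close>.
\<close>

lemma prime_below_avoiding:
  assumes P: "prime_filter P" and a: "a \<notin> D_filter P"
  shows "\<exists>Q. prime_filter Q \<and> Q \<subseteq> P \<and> a \<notin> Q"
proof -
  let ?S = "{s. \<exists>x. x \<notin> P \<and> (s = x \<or> s = sup a x)}"
  have P_sup: "sup x y \<notin> P" if "x \<notin> P" "y \<notin> P" for x y
    using prime_filter_sup[OF P] that by blast
  have closed: "sup s t \<in> ?S" if st: "s \<in> ?S" "t \<in> ?S" for s t
  proof -
    obtain x y where xy: "x \<notin> P" "y \<notin> P" "s = x \<or> s = sup a x" "t = y \<or> t = sup a y"
      using st by blast
    have "sup (sup a x) (sup a y) = sup a (sup x y)" "sup (sup a x) y = sup a (sup x y)"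
      "sup x (sup a y) = sup a (sup x y)"
      by (simp_all add: sup.assoc sup.left_commute)
    then have "sup s t = sup x y \<or> sup s t = sup a (sup x y)" using xy(3,4) by auto
    then show ?thesis using P_sup[OF xy(1,2)] by blast
  qed
  have "{1} \<inter> ?S = {}"
    using a rl_filter_one[OF prime_filter_is_filter[OF P]] by (auto simp: D_filter_def)
  moreover have "?S \<noteq> {}" using prime_filter_bot[OF P] by blast
  ultimately obtain Q where Q: "prime_filter Q" "Q \<inter> ?S = {}"
    using prime_filter_separation[OF rl_filter_singleton_one _ _ closed] by blast
  have "a \<in> ?S" using prime_filter_bot[OF P] by (auto intro!: exI[of _ bot])
  then show ?thesis using Q by blast
qed

lemma minimal_prime_below_avoiding:
  assumes "prime_filter P" "a \<notin> D_filter P"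
  shows "\<exists>M. minimal_prime_filter M \<and> M \<subseteq> P \<and> a \<notin> M"
proof -
  obtain Q where "prime_filter Q" "Q \<subseteq> P" "a \<notin> Q"
    using prime_below_avoiding[OF assms] by blast
  then show ?thesis using exists_minimal_prime_below by (metis subset_iff)
qed

lemma D_filter_minimal_prime:
  assumes "minimal_prime_filter M"
  shows "D_filter M = M"
proof
  have M: "prime_filter M" using assms by (simp add: minimal_prime_filter_def)
  show "D_filter M \<subseteq> M" by (rule D_filter_subset_prime[OF M])
  show "M \<subseteq> D_filter M"
    using prime_below_avoiding[OF M] assms unfolding minimal_prime_filter_def by blast
qed

section \<open>The characterizations\<close>

lemma mp_residuated_latticeI:
  assumes "\<And>P M N :: 'a::residuated_lattice set. prime_filter P \<Longrightarrow>
    minimal_prime_filter M \<Longrightarrow> M \<subseteq> P \<Longrightarrow> minimal_prime_filter N \<Longrightarrow> N \<subseteq> P \<Longrightarrow> M = N"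
  shows "mp_residuated_lattice TYPE('a)"
  unfolding mp_residuated_lattice_def
proof (intro allI impI)
  fix P :: "'a set" assume P: "prime_filter P"
  obtain M where "minimal_prime_filter M" "M \<subseteq> P"
    using exists_minimal_prime_below[OF P] by (elim exE conjE)
  then show "\<exists>!M. minimal_prime_filter M \<and> M \<subseteq> P"
    by (intro ex1I[of _ M]) (simp_all add: assms[OF P])
qed

lemma mp_residuated_lattice_unique:
  fixes P :: "'a::residuated_lattice set"
  assumes "mp_residuated_lattice TYPE('a)" "prime_filter P"
    and "minimal_prime_filter M" "M \<subseteq> P" "minimal_prime_filter N" "N \<subseteq> P"
  shows "M = N"
proof -
  have "\<exists>!M. minimal_prime_filter M \<and> M \<subseteq> P"
    using assms(1,2) by (simp add: mp_residuated_lattice_def)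
  then show ?thesis
    using assms(3-6) by (elim ex1E) metis
qed

lemma comaximal_minimal_primes_imp_mp:
  assumes "\<And>M N :: 'a::residuated_lattice set.
    minimal_prime_filter M \<Longrightarrow> minimal_prime_filter N \<Longrightarrow> M \<noteq> N \<Longrightarrow> M \<squnion>\<^sub>F N = UNIV"
  shows "mp_residuated_lattice TYPE('a)"
proof (rule mp_residuated_latticeI, rule ccontr)
  fix P M N :: "'a set"
  assume P: "prime_filter P" and M: "minimal_prime_filter M" "M \<subseteq> P"
    and N: "minimal_prime_filter N" "N \<subseteq> P" and "M \<noteq> N"
  then have "bot \<in> M \<squnion>\<^sub>F N" by (simp add: assms)
  then show False
    using filter_join_least[OF prime_filter_is_filter[OF P] M(2) N(2)] prime_filter_bot[OF P]
    by blast
qed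

lemma mp_imp_D_filter_prime:
  fixes P :: "'a::residuated_lattice set"
  assumes mp: "mp_residuated_lattice TYPE('a)" and P: "prime_filter P"
  shows "prime_filter (D_filter P)"
proof -
  obtain M where M: "minimal_prime_filter M" "M \<subseteq> P"
    using exists_minimal_prime_below[OF P] by (elim exE conjE)
  have "D_filter P \<subseteq> M"
    using D_filter_antimono[OF M(2)] D_filter_minimal_prime[OF M(1)] by blast
  moreover have "M \<subseteq> D_filter P"
    using minimal_prime_below_avoiding[OF P] mp_residuated_lattice_unique[OF mp P M] by blast
  ultimately show ?thesis
    using M(1) by (simp add: minimal_prime_filter_def subset_antisym)
qed

text \<open>
  A minimal prime \<open>M\<close> below a maximal filter \<open>H\<close> satisfies \<open>D(H) \<subseteq> D(M) = M\<close>, so by minimality it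
  equals the prime filter \<open>D(H)\<close>, whichever \<open>M\<close> one starts from.
\<close>

lemma D_filter_maximal_prime_imp_mp:
  assumes D: "\<And>H :: 'a::residuated_lattice set. maximal_filter H \<Longrightarrow> prime_filter (D_filter H)"
  shows "mp_residuated_lattice TYPE('a)"
proof (rule mp_residuated_latticeI)
  fix P M N :: "'a set"
  assume P: "prime_filter P" and M: "minimal_prime_filter M" "M \<subseteq> P"
    and N: "minimal_prime_filter N" "N \<subseteq> P"
  obtain H where H: "maximal_filter H" "P \<subseteq> H"
    using exists_maximal_filter_above[of P] P by (auto simp: prime_filter_def)
  have eq: "K = D_filter H" if K: "minimal_prime_filter K" "K \<subseteq> P" for K
  proof -
    have "D_filter H \<subseteq> K"
      using D_filter_antimono[of K H] D_filter_minimal_prime[OF K(1)] K(2) H(2) by blast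
    then show ?thesis
      using K(1) D[OF H(1)] by (auto simp: minimal_prime_filter_def)
  qed
  show "M = N" using eq[OF M] eq[OF N] by simp
qed

text \<open>
  For a prime \<open>P\<close>, the inclusion \<open>perp x \<subseteq> P\<close> means \<open>x \<notin> D(P)\<close>. So a prime containing both \<open>perp x\<close>
  and \<open>perp y\<close> contains a minimal prime avoiding \<open>x\<close> and one avoiding \<open>y\<close>.
\<close>

lemma mp_imp_perp_comaximal:
  fixes x y :: "'a::residuated_lattice"
  assumes mp: "mp_residuated_lattice TYPE('a)" and xy: "sup x y = 1"
  shows "perp x \<squnion>\<^sub>F perp y = UNIV"
proof (rule ccontr)
  let ?J = "perp x \<squnion>\<^sub>F perp y"
  assume "?J \<noteq> UNIV"
  then have "?J \<inter> {bot} = {}"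
    using rl_filter_eq_UNIV_iff[OF rl_filter_join] by blast
  then obtain P where P: "prime_filter P" "?J \<subseteq> P"
    using prime_filter_separation[OF rl_filter_join, of "perp x" "perp y" "{bot}"]
    by auto
  have avoid: "z \<notin> D_filter P" if "perp z \<subseteq> P" for z
    using that sup.commute[of z] unfolding D_filter_def perp_def by force
  have avoiding: "\<exists>M. minimal_prime_filter M \<and> M \<subseteq> P \<and> z \<notin> M" if "perp z \<subseteq> P" for z
    by (rule minimal_prime_below_avoiding[OF P(1) avoid[OF that]])
  obtain M where M: "minimal_prime_filter M" "M \<subseteq> P" "x \<notin> M"
    using avoiding[OF order_trans[OF filter_join_upper(1) P(2)]] by (elim exE conjE)
  obtain N where N: "minimal_prime_filter N" "N \<subseteq> P" "y \<notin> N"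
    using avoiding[OF order_trans[OF filter_join_upper(2) P(2)]] by (elim exE conjE)
  have "M = N"
    by (rule mp_residuated_lattice_unique[OF mp P(1) M(1,2) N(1,2)])
  moreover have "prime_filter M" using M(1) by (simp add: minimal_prime_filter_def)
  ultimately show False
    using prime_filter_sup[of M x y] xy M(3) N(3) rl_filter_one[OF prime_filter_is_filter] by metis
qed

lemma perp_comaximal_imp_minimal_primes_comaximal:
  fixes M N :: "'a::residuated_lattice set"
  assumes perp: "\<And>x y :: 'a. sup x y = 1 \<Longrightarrow> perp x \<squnion>\<^sub>F perp y = UNIV"
    and M: "minimal_prime_filter M" and N: "minimal_prime_filter N" and "M \<noteq> N"
  shows "M \<squnion>\<^sub>F N = UNIV"
proof -
  have prime: "prime_filter M" "prime_filter N"
    using M N by (simp_all add: minimal_prime_filter_def)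
  have "\<not> M \<subseteq> N"
    using N prime(1) \<open>M \<noteq> N\<close> unfolding minimal_prime_filter_def by blast
  then obtain x where x: "x \<in> M" "x \<notin> N" by blast
  \<comment> \<open>\<open>D(M) = M\<close> provides a partner of \<open>x\<close> outside \<open>M\<close>.\<close>
  then obtain y where y: "y \<notin> M" "sup x y = 1"
    using D_filter_minimal_prime[OF M] unfolding D_filter_def by blast
  have "perp y \<squnion>\<^sub>F perp x \<subseteq> M \<squnion>\<^sub>F N"
    by (rule filter_join_mono[OF perp_subset_prime[OF prime(1) y(1)]
          perp_subset_prime[OF prime(2) x(2)]])
  moreover have "perp y \<squnion>\<^sub>F perp x = UNIV"
    using perp y(2) by (simp add: sup.commute)
  ultimately show ?thesis by blast
qed

lemma perp_comaximal_iff: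
  "perp x \<squnion>\<^sub>F perp y = UNIV \<longleftrightarrow> (\<exists>a. a \<in> perp x \<and> rneg a \<in> perp y)"
proof -
  have "perp x \<squnion>\<^sub>F perp y = UNIV \<longleftrightarrow> (\<exists>a\<in>perp x. \<exists>b\<in>perp y. b * a \<le> bot)"
    by (simp add: rl_filter_eq_UNIV_iff rl_filter_join rl_filter_perp mem_filter_join_iff
        mult.commute)
  also have "\<dots> \<longleftrightarrow> (\<exists>a\<in>perp x. \<exists>b\<in>perp y. b \<le> rneg a)"
    by (simp add: residuation rneg_def)
  also have "\<dots> \<longleftrightarrow> (\<exists>a. a \<in> perp x \<and> rneg a \<in> perp y)"
    using rl_filter_up[OF rl_filter_perp] by blast
  finally show ?thesis .
qed

text \<open>
  If \<open>z \<in> perp (sup x y)\<close>, then \<open>sup z x\<close> and \<open>y\<close> join to \<open>1\<close>, and comaximality of their \<open>perp\<close>s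
  gives \<open>a\<close> and \<open>b\<close> with \<open>a * b = bot\<close>. Now \<open>sup z a \<in> perp x\<close> and \<open>sup z b \<in> perp y\<close> have a
  product below \<open>sup z (a * b) = z\<close>.
\<close>

lemma perp_comaximal_imp_perp_sup:
  fixes x y :: "'a::residuated_lattice"
  assumes comax: "\<And>x y :: 'a. sup x y = 1 \<Longrightarrow> perp x \<squnion>\<^sub>F perp y = UNIV"
  shows "perp (sup x y) = perp x \<squnion>\<^sub>F perp y"
proof
  have "sup z (sup x y) = 1" if "sup z x = 1 \<or> sup z y = 1" for z
    using that by (metis sup.assoc sup.left_commute sup_one_rl)
  then show "perp x \<squnion>\<^sub>F perp y \<subseteq> perp (sup x y)"
    by (intro filter_join_least rl_filter_perp) (auto simp: mem_perp_iff)
next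
  show "perp (sup x y) \<subseteq> perp x \<squnion>\<^sub>F perp y"
  proof
    fix z assume "z \<in> perp (sup x y)"
    then have "sup (sup z x) y = 1" by (simp add: mem_perp_iff sup.assoc)
    then have "bot \<in> perp (sup z x) \<squnion>\<^sub>F perp y" using comax by blast
    then obtain a b where ab: "sup a (sup z x) = 1" "sup b y = 1" "a * b \<le> bot"
      by (auto simp: mem_filter_join_iff rl_filter_perp mem_perp_iff)
    have "sup z a \<in> perp x"
      using ab(1) by (simp add: mem_perp_iff ac_simps)
    moreover have "sup z b \<in> perp y"
      using ab(2) by (simp add: mem_perp_iff sup.assoc)
    moreover have "sup z a * sup z b \<le> z"
      using sup_mult_sup_le[of z a b] ab(3) by (simp add: bot_unique)
    ultimately show "z \<in> perp x \<squnion>\<^sub>F perp y"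
      unfolding mem_filter_join_iff[OF rl_filter_perp rl_filter_perp] by blast
  qed
qed

lemma perp_eq_UNIV_iff: "perp x = UNIV \<longleftrightarrow> x = 1"
  by (simp add: rl_filter_eq_UNIV_iff[OF rl_filter_perp] mem_perp_iff)

theorem theorem3p5:
  shows
    "((\<forall>M N :: 'a::residuated_lattice set.
         minimal_prime_filter M \<and> minimal_prime_filter N \<and> M \<noteq> N \<longrightarrow> M \<squnion>\<^sub>F N = UNIV)
       \<longleftrightarrow> mp_residuated_lattice TYPE('a)) \<and>
     (mp_residuated_lattice TYPE('a) \<longleftrightarrow>
       (\<forall>P :: 'a set. prime_filter P \<longrightarrow> prime_filter (D_filter P))) \<and>
     (mp_residuated_lattice TYPE('a) \<longleftrightarrow>
       (\<forall>M :: 'a set. maximal_filter M \<longrightarrow> prime_filter (D_filter M))) \<and>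
     (mp_residuated_lattice TYPE('a) \<longleftrightarrow>
       (\<forall>x y :: 'a. sup x y = 1 \<longrightarrow> perp x \<squnion>\<^sub>F perp y = UNIV)) \<and>
     (mp_residuated_lattice TYPE('a) \<longleftrightarrow>
       (\<forall>x y :: 'a. sup x y = 1 \<longrightarrow> (\<exists>a. a \<in> perp x \<and> rneg a \<in> perp y))) \<and>
     (mp_residuated_lattice TYPE('a) \<longleftrightarrow>
       (\<forall>x y :: 'a. perp (sup x y) = perp x \<squnion>\<^sub>F perp y)) \<and>
     (mp_residuated_lattice TYPE('a) \<longleftrightarrow>
       (\<forall>x y :: 'a. perp (sup x y) = UNIV \<longrightarrow> perp x \<squnion>\<^sub>F perp y = UNIV))"
proof -
  let ?mp = "mp_residuated_lattice TYPE('a)"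
  let ?comax = "\<forall>M N :: 'a set.
    minimal_prime_filter M \<and> minimal_prime_filter N \<and> M \<noteq> N \<longrightarrow> M \<squnion>\<^sub>F N = UNIV"
  let ?perp = "\<forall>x y :: 'a. sup x y = 1 \<longrightarrow> perp x \<squnion>\<^sub>F perp y = UNIV"
  let ?perp_sup = "\<forall>x y :: 'a. perp (sup x y) = perp x \<squnion>\<^sub>F perp y"
  have comax: "?comax \<longleftrightarrow> ?mp" and perp: "?mp \<longleftrightarrow> ?perp"
    using comaximal_minimal_primes_imp_mp[where 'a = 'a] mp_imp_perp_comaximal[where 'a = 'a]
      perp_comaximal_imp_minimal_primes_comaximal[where 'a = 'a] by metis+
  have D: "?mp \<longleftrightarrow> (\<forall>P :: 'a set. prime_filter P \<longrightarrow> prime_filter (D_filter P))"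
    and D_max: "?mp \<longleftrightarrow> (\<forall>M :: 'a set. maximal_filter M \<longrightarrow> prime_filter (D_filter M))"
    using mp_imp_D_filter_prime[where 'a = 'a] D_filter_maximal_prime_imp_mp[where 'a = 'a]
      maximal_filter_prime[where 'a = 'a] by blast+
  have neg: "?mp \<longleftrightarrow>
      (\<forall>x y :: 'a. sup x y = 1 \<longrightarrow> (\<exists>a. a \<in> perp x \<and> rneg a \<in> perp y))"
    using perp by (simp add: perp_comaximal_iff)
  have perp_UNIV: "?mp \<longleftrightarrow>
      (\<forall>x y :: 'a. perp (sup x y) = UNIV \<longrightarrow> perp x \<squnion>\<^sub>F perp y = UNIV)"
    using perp by (simp add: perp_eq_UNIV_iff)
  have "?perp \<longrightarrow> ?perp_sup"
    using perp_comaximal_imp_perp_sup[where 'a = 'a] by blast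
  then have perp_sup: "?mp \<longleftrightarrow> ?perp_sup"
    using perp perp_UNIV by metis
  show ?thesis
    using comax D D_max perp neg perp_sup perp_UNIV by (intro conjI)
qed

end
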